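(* Let $N_0,\dots,N_d$ be nonnegative integers with $\sum_jN_j=n$, $p=(p_0,\dots,p_d)$ with $p_j=N_j/n$, and $p_{\min}=\min_{0\le j\le d}p_j$. Let $\pi^d$ be the marginal distribution of $(\theta_1,\dots,\theta_d)$ when $(\theta_0,\dots,\theta_d)\sim\mathrm{Dir}(N_0+1,\dots,N_d+1)$, with mean $\bar\theta^d$ and mode $\hat\theta^d$, and let $\delta\hat\theta^d$ and $H_V$ be as in the context. Suppose $p_0,\dots,p_d>0$. Then $$\|\delta\hat\theta^d\|_{H_V}\lesssim\Big(\sqrt{\chi^2(\mathrm{Unif}_{d+1}\|p)}+1\Big)\frac{d}{\sqrt n}.$$ If additionally $d^2/(np_{\min})$ is smaller than a certain small absolute constant, then $$\|\bar\theta^d-\hat\theta^d-\delta\hat\theta^d\|_{H_V}\lesssim\Big(\frac{d}{\sqrt{np_{\min}}}\Big)^3+\tau,$$ where $\tau=d\exp\big(-C\sqrt d\,(np_{\min})^{1/4}\big)$.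
   Context: Let $\Theta^d=\{(\theta_1,\dots,\theta_d):0<\theta_1+\dots+\theta_d<1,\ 0<\theta_i<1\ \forall i\}$ and $v^d(\theta^d)=-p_0\log\big(1-\sum_{j=1}^d\theta_j\big)-\sum_{j=1}^dp_j\log\theta_j$ on $\Theta^d$. When all $N_j>0$, $\pi^d\propto e^{-nv^d}$ on $\Theta^d$ and $v^d$ is strictly convex with unique minimizer (the mode of $\pi^d$) $\hat\theta^d=p^d=(p_1,\dots,p_d)$. Put $V=nv^d$, $H_V=\nabla^2V(p^d)$, and $\delta\hat\theta^d=-\frac12H_V^{-1}\langle\nabla^3V(p^d),H_V^{-1}\rangle$ (the skew correction to the mode), where $\langle T,A\rangle_i=\sum_{j,k}T_{ijk}A_{jk}$. $\|x\|_H=\sqrt{x^\top Hx}$. $\mathrm{Unif}_{d+1}$ is the uniform probability mass function on $d+1$ states, and $\chi^2(q\|p)=\sum_{j=0}^d(q_j-p_j)^2/p_j$. $C>0$ is an absolute constant, and $a\lesssim b$ means $a\le C'b$ for an absolute constant $C'>0$. *)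

theory Defs
  imports "HOL-Probability.Probability"
begin

text \<open>
  The constants of the theorem are uniform in the dimension \<open>d\<close>, so \<open>d\<close> cannot be encoded in a
  type. Points of \<open>\<real>\<^sup>d\<close> are functions on \<open>nat\<close> with relevant indices \<open>{1..d}\<close>, points of \<open>\<real>\<^sup>d\<^sup>+\<^sup>1\<close> are
  functions with relevant indices \<open>{0..d}\<close>; matrices are treated likewise. Points of the parameter
  space are extensional, as required by \<open>Pi\<^sub>M\<close>.
\<close>

subsection \<open>The Dirichlet distribution and its marginal\<close>

definition open_simplex :: "nat \<Rightarrow> (nat \<Rightarrow> real) set" where
  "open_simplex d = {\<theta> \<in> extensional {1..d}.
     0 < (\<Sum>i=1..d. \<theta> i) \<and> (\<Sum>i=1..d. \<theta> i) < 1 \<and> (\<forall>i\<in>{1..d}. 0 < \<theta> i \<and> \<theta> i < 1)}"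

definition multi_Beta :: "nat \<Rightarrow> (nat \<Rightarrow> real) \<Rightarrow> real" where
  "multi_Beta d \<alpha> = (\<Prod>j=0..d. Gamma (\<alpha> j)) / Gamma (\<Sum>j=0..d. \<alpha> j)"

text \<open>Lebesgue density of the coordinates \<open>\<theta>\<^sub>1, \<dots>, \<theta>\<^sub>d\<close>; the remaining one is
  \<open>\<theta>\<^sub>0 = 1 - (\<theta>\<^sub>1 + \<dots> + \<theta>\<^sub>d)\<close>.\<close>

definition Dir_density :: "nat \<Rightarrow> (nat \<Rightarrow> real) \<Rightarrow> (nat \<Rightarrow> real) \<Rightarrow> real" where
  "Dir_density d \<alpha> \<theta> = indicator (open_simplex d) \<theta> *
     ((1 - (\<Sum>j=1..d. \<theta> j)) powr (\<alpha> 0 - 1) * (\<Prod>j=1..d. \<theta> j powr (\<alpha> j - 1)) / multi_Beta d \<alpha>)"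

definition Dir :: "nat \<Rightarrow> (nat \<Rightarrow> real) \<Rightarrow> (nat \<Rightarrow> real) measure" where
  "Dir d \<alpha> = distr (density (\<Pi>\<^sub>M i\<in>{1..d}. lborel) (\<lambda>\<theta>. ennreal (Dir_density d \<alpha> \<theta>)))
     (\<Pi>\<^sub>M i\<in>{0..d}. lborel) (\<lambda>\<theta>. \<theta>(0 := 1 - (\<Sum>j=1..d. \<theta> j)))"

definition Dir_marginal :: "nat \<Rightarrow> (nat \<Rightarrow> real) \<Rightarrow> (nat \<Rightarrow> real) measure" where
  "Dir_marginal d \<alpha> = distr (Dir d \<alpha>) (\<Pi>\<^sub>M i\<in>{1..d}. lborel) (\<lambda>\<theta>. restrict \<theta> {1..d})"

lemma Dir_density_measurable [measurable]:
  "Dir_density d \<alpha> \<in> borel_measurable (\<Pi>\<^sub>M i\<in>{1..d}. lborel)"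
proof -
  let ?M = "\<Pi>\<^sub>M i\<in>{1..d}. (lborel :: real measure)"
  have *: "open_simplex d = {\<theta> \<in> space ?M. 0 < (\<Sum>i=1..d. \<theta> i) \<and> (\<Sum>i=1..d. \<theta> i) < 1 \<and>
      (\<forall>i\<in>{1..d}. 0 < \<theta> i \<and> \<theta> i < 1)}"
    by (auto simp: open_simplex_def space_PiM PiE_def)
  have [measurable]: "open_simplex d \<in> sets ?M"
    unfolding * by measurable
  show ?thesis
    unfolding Dir_density_def by measurable
qed

text \<open>The marginal has the density \<open>Dir_density\<close>; its mode is therefore the maximiser of this
  (on \<open>open_simplex\<close> continuous) density.\<close>

lemma Dir_marginal_eq_density:
  "Dir_marginal d \<alpha> = density (\<Pi>\<^sub>M i\<in>{1..d}. lborel) (\<lambda>\<theta>. ennreal (Dir_density d \<alpha> \<theta>))"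
proof -
  let ?M = "\<Pi>\<^sub>M i\<in>{1..d}. (lborel :: real measure)"
  let ?D = "density ?M (\<lambda>\<theta>. ennreal (Dir_density d \<alpha> \<theta>))"
  have ins: "{0..d} = insert 0 {1..d}" by auto
  have m1: "(\<lambda>\<theta>. \<theta>(0 := 1 - (\<Sum>j=1..d. \<theta> j))) \<in> measurable ?D (\<Pi>\<^sub>M i\<in>{0..d}. lborel)"
    unfolding ins by (rule measurable_fun_upd[where J = "{1..d}"]) auto
  have m2: "(\<lambda>\<theta>. restrict \<theta> {1..d}) \<in> measurable (\<Pi>\<^sub>M i\<in>{0..d}. lborel) ?M"
    by (rule measurable_restrict_subset) auto
  have "Dir_marginal d \<alpha> = distr ?D ?M (\<lambda>\<theta>. restrict (\<theta>(0 := 1 - (\<Sum>j=1..d. \<theta> j))) {1..d})"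
    unfolding Dir_marginal_def Dir_def by (subst distr_distr[OF m2 m1]) (simp add: o_def)
  also have "\<dots> = distr ?D ?D (\<lambda>\<theta>. \<theta>)"
    by (rule distr_cong)
      (auto simp: space_PiM PiE_def extensional_def restrict_def fun_eq_iff)
  finally show ?thesis by simp
qed

definition Dir_mean :: "nat \<Rightarrow> (nat \<Rightarrow> real) \<Rightarrow> nat \<Rightarrow> real" where
  "Dir_mean d \<alpha> i = (\<integral>\<theta>. \<theta> i \<partial>Dir_marginal d \<alpha>)"

definition Dir_mode :: "nat \<Rightarrow> (nat \<Rightarrow> real) \<Rightarrow> nat \<Rightarrow> real" where
  "Dir_mode d \<alpha> = (THE \<theta>. is_arg_max (Dir_density d \<alpha>) (\<lambda>\<theta>. \<theta> \<in> open_simplex d) \<theta>)"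

subsection \<open>Linear algebra and derivatives in coordinates\<close>

definition partial :: "nat \<Rightarrow> ((nat \<Rightarrow> real) \<Rightarrow> real) \<Rightarrow> (nat \<Rightarrow> real) \<Rightarrow> real" where
  "partial i f x = deriv (\<lambda>t. f (x(i := t))) (x i)"

definition hess :: "((nat \<Rightarrow> real) \<Rightarrow> real) \<Rightarrow> (nat \<Rightarrow> real) \<Rightarrow> nat \<Rightarrow> nat \<Rightarrow> real" where
  "hess f x i j = partial i (partial j f) x"

definition third :: "((nat \<Rightarrow> real) \<Rightarrow> real) \<Rightarrow> (nat \<Rightarrow> real) \<Rightarrow> nat \<Rightarrow> nat \<Rightarrow> nat \<Rightarrow> real" where
  "third f x i j k = partial i (partial j (partial k f)) x"

text \<open>The inverse of a \<open>d \<times> d\<close> matrix, padded with zeros outside the index range to make it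
  unique as a function.\<close>

definition minv :: "nat \<Rightarrow> (nat \<Rightarrow> nat \<Rightarrow> real) \<Rightarrow> nat \<Rightarrow> nat \<Rightarrow> real" where
  "minv d A = (THE B.
     (\<forall>i\<in>{1..d}. \<forall>k\<in>{1..d}. (\<Sum>j=1..d. A i j * B j k) = (if i = k then 1 else 0)) \<and>
     (\<forall>i\<in>{1..d}. \<forall>k\<in>{1..d}. (\<Sum>j=1..d. B i j * A j k) = (if i = k then 1 else 0)) \<and>
     (\<forall>i j. i \<notin> {1..d} \<or> j \<notin> {1..d} \<longrightarrow> B i j = 0))"

definition wnorm :: "nat \<Rightarrow> (nat \<Rightarrow> nat \<Rightarrow> real) \<Rightarrow> (nat \<Rightarrow> real) \<Rightarrow> real" where
  "wnorm d H x = sqrt (\<Sum>i=1..d. \<Sum>j=1..d. x i * H i j * x j)"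

text \<open>The skew correction \<open>- 1/2 H\<^sup>-\<^sup>1 \<langle>\<nabla>\<^sup>3 V(x), H\<^sup>-\<^sup>1\<rangle>\<close> with \<open>H = \<nabla>\<^sup>2 V(x)\<close>.\<close>

definition skew_correction :: "nat \<Rightarrow> ((nat \<Rightarrow> real) \<Rightarrow> real) \<Rightarrow> (nat \<Rightarrow> real) \<Rightarrow> nat \<Rightarrow> real" where
  "skew_correction d V x i = (let Hinv = minv d (hess V x) in
     - (1/2) * (\<Sum>l=1..d. Hinv i l * (\<Sum>j=1..d. \<Sum>k=1..d. third V x l j k * Hinv j k)))"

subsection \<open>The multinomial model\<close>

definition total_count :: "nat \<Rightarrow> (nat \<Rightarrow> nat) \<Rightarrow> nat" where
  "total_count d N = (\<Sum>j=0..d. N j)"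

definition freq :: "nat \<Rightarrow> (nat \<Rightarrow> nat) \<Rightarrow> nat \<Rightarrow> real" where
  "freq d N j = real (N j) / real (total_count d N)"

definition freq_min :: "nat \<Rightarrow> (nat \<Rightarrow> nat) \<Rightarrow> real" where
  "freq_min d N = Min (freq d N ` {0..d})"

definition v_pot :: "nat \<Rightarrow> (nat \<Rightarrow> nat) \<Rightarrow> (nat \<Rightarrow> real) \<Rightarrow> real" where
  "v_pot d N \<theta> = - freq d N 0 * ln (1 - (\<Sum>j=1..d. \<theta> j)) - (\<Sum>j=1..d. freq d N j * ln (\<theta> j))"

definition V_pot :: "nat \<Rightarrow> (nat \<Rightarrow> nat) \<Rightarrow> (nat \<Rightarrow> real) \<Rightarrow> real" where
  "V_pot d N \<theta> = real (total_count d N) * v_pot d N \<theta>"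

definition p_pt :: "nat \<Rightarrow> (nat \<Rightarrow> nat) \<Rightarrow> nat \<Rightarrow> real" where
  "p_pt d N = restrict (freq d N) {1..d}"

definition H_V :: "nat \<Rightarrow> (nat \<Rightarrow> nat) \<Rightarrow> nat \<Rightarrow> nat \<Rightarrow> real" where
  "H_V d N = hess (V_pot d N) (p_pt d N)"

definition chi2 :: "nat \<Rightarrow> (nat \<Rightarrow> real) \<Rightarrow> (nat \<Rightarrow> real) \<Rightarrow> real" where
  "chi2 d q p = (\<Sum>j=0..d. (q j - p j)\<^sup>2 / p j)"

definition Unif :: "nat \<Rightarrow> nat \<Rightarrow> real" where
  "Unif d = pmf (pmf_of_set {0..d})"

end

theory Submission
  imports Defs
begin

text \<open>
  Everything is explicit. The mean of the Dirichlet law is \<open>(n p\<^sub>i + 1) / (n + d + 1)\<close>, its mode is \<open>p\<close>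
  by Gibbs' inequality, and since \<open>H\<^sub>V = n (diag (1 / p\<^sub>i) + 1 1\<^sup>T / p\<^sub>0)\<close> has inverse
  \<open>(diag p - p p\<^sup>T) / n\<close>, the skew correction is \<open>\<delta>\<^sub>i = (1 - (d + 1) p\<^sub>i) / n\<close>. Extending a vector by the
  coordinate \<open>x\<^sub>0 = - (x\<^sub>1 + \<dots> + x\<^sub>d)\<close> turns \<open>\<parallel>x\<parallel>\<^sup>2\<close> into \<open>n (\<Sum>\<^sub>j x\<^sub>j\<^sup>2 / p\<^sub>j)\<close>, whence
  \<open>\<parallel>\<delta>\<parallel> = (d + 1) \<surd>(\<chi>\<^sup>2 / n)\<close> exactly. Moreover mean minus mode is \<open>n / (n + d + 1) \<cdot> \<delta>\<close>, so the
  remainder is \<open>- (d + 1) / (n + d + 1) \<cdot> \<delta>\<close>, and \<open>\<chi>\<^sup>2 \<le> 1 / p\<^sub>m\<^sub>i\<^sub>n\<close> bounds it by the cubic term.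
\<close>

section \<open>The Dirichlet integral\<close>

text \<open>Substituting \<open>s * x\<close> for \<open>x\<close> reduces this to Euler's Beta
  integral; the two powers and the Jacobian contribute the exponent
  \<open>(a - 1) + (b - 1) + 1\<close>. The indicator on the right covers \<open>s\<close> \<le> 0,
  where both sides vanish.\<close>

lemma nn_integral_Beta_scaled:
  fixes a b s :: real
  assumes "a > 0" "b > 0"
  shows "(\<integral>\<^sup>+x. ennreal (indicator {0<..<s} x * (x powr (a - 1) * (s - x) powr (b - 1))) \<partial>lborel)
    = ennreal (indicator {0<..} s * (s powr (a + b - 1) * Beta a b))"
proof (cases "s > 0")
  case True
  have "(\<integral>\<^sup>+x. ennreal (indicator {0<..<s} x * (x powr (a - 1) * (s - x) powr (b - 1))) \<partial>lborel)
    = ennreal s * (\<integral>\<^sup>+x. ennreal (indicator {0<..<s} (s * x) *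
        ((s * x) powr (a - 1) * (s - s * x) powr (b - 1))) \<partial>lborel)"
    using nn_integral_real_affine[of "\<lambda>x. ennreal (indicator {0<..<s} x *
        (x powr (a - 1) * (s - x) powr (b - 1)))" s 0] True by simp
  also have "(\<lambda>x. indicator {0<..<s} (s * x) * ((s * x) powr (a - 1) * (s - s * x) powr (b - 1)))
     = (\<lambda>x. s powr (a + b - 2) * (indicator {0<..<1} x * (x powr (a - 1) * (1 - x) powr (b - 1))))"
  proof (rule ext, goal_cases)
    case (1 x)
    have eq: "(s * x) powr (a - 1) * (s - s * x) powr (b - 1)
        = s powr (a + b - 2) * (x powr (a - 1) * (1 - x) powr (b - 1))" if "0 < x" "x < 1"
    proof -
      have "(s - s * x) powr (b - 1) = s powr (b - 1) * (1 - x) powr (b - 1)"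
        using that True by (simp add: powr_mult flip: right_diff_distrib[of s 1 x, simplified])
      moreover have "s powr (a + b - 2) = s powr (a - 1) * s powr (b - 1)"
        by (simp flip: powr_add)
      ultimately show ?thesis
        using that True by (simp add: powr_mult)
    qed
    show ?case
      using eq True by (auto simp: indicator_def zero_less_mult_iff)
  qed
  also have "(\<integral>\<^sup>+x. ennreal (s powr (a + b - 2) *
        (indicator {0<..<1} x * (x powr (a - 1) * (1 - x) powr (b - 1)))) \<partial>lborel)
     = ennreal (s powr (a + b - 2)) * (\<integral>\<^sup>+x. ennreal (indicator {0<..<1} x *
        (x powr (a - 1) * (1 - x) powr (b - 1))) \<partial>lborel)"
    by (simp add: ennreal_mult' nn_integral_cmult)
  also have "(\<integral>\<^sup>+x. ennreal (indicator {0<..<1} x * (x powr (a - 1) * (1 - x) powr (b - 1))) \<partial>lborel)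
     = ennreal (Beta a b)"
    using has_integral_Beta_real[OF assms]
    by (intro nn_integral_has_integral_lebesgue) (auto simp: has_integral_Icc_iff_Ioo)
  also have "ennreal s * (ennreal (s powr (a + b - 2)) * ennreal (Beta a b))
     = ennreal (s powr (a + b - 1) * Beta a b)"
  proof -
    have "Beta a b \<ge> 0"
      using assms by (simp add: Beta_def)
    moreover have "s powr (a + b - 1) = s * s powr (a + b - 2)"
      using True powr_mult_base[of s "a + b - 2"] by simp
    ultimately show ?thesis
      using True by (simp add: mult.assoc flip: ennreal_mult)
  qed
  finally show ?thesis
    using True by simp
qed (simp add: indicator_def)

text \<open>Dirichlet's integral over a simplex of size \<open>s\<close>, with \<open>a\<close> as
  the parameter of the slack \<open>s - sum \<theta> I\<close>. Fixing one coordinate at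
  \<open>y\<close> leaves a simplex of size \<open>s - y\<close>, so the induction generalises over
  \<open>s\<close> and each step costs one Beta integral.\<close>

lemma nn_integral_simplex:
  fixes \<alpha> :: "'i \<Rightarrow> real"
  assumes "finite I" "a > 0" "\<And>i. i \<in> I \<Longrightarrow> \<alpha> i > 0"
  shows "(\<integral>\<^sup>+\<theta>. ennreal (of_bool ((\<forall>i\<in>I. 0 < \<theta> i) \<and> sum \<theta> I < s) *
        ((s - sum \<theta> I) powr (a - 1) * (\<Prod>i\<in>I. \<theta> i powr (\<alpha> i - 1)))) \<partial>(\<Pi>\<^sub>M i\<in>I. lborel))
    = ennreal (of_bool (0 < s) * (s powr (a + sum \<alpha> I - 1) *
        (Gamma a * (\<Prod>i\<in>I. Gamma (\<alpha> i)) / Gamma (a + sum \<alpha> I))))"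
  using assms(1,3)
proof (induction I arbitrary: s rule: finite_induct)
  case empty
  then show ?case
    using Gamma_real_pos[OF assms(2)]
    by (simp add: PiM_empty nn_integral_count_space_finite)
next
  case (insert i I)
  interpret product_sigma_finite "\<lambda>_. lborel :: real measure"
    by standard
  define K :: "'i set \<Rightarrow> real \<Rightarrow> ('i \<Rightarrow> real) \<Rightarrow> real" where
    "K J s \<theta> = of_bool ((\<forall>i\<in>J. 0 < \<theta> i) \<and> sum \<theta> J < s) *
        ((s - sum \<theta> J) powr (a - 1) * (\<Prod>i\<in>J. \<theta> i powr (\<alpha> i - 1)))" for J s \<theta>
  define G where "G J = Gamma a * (\<Prod>i\<in>J. Gamma (\<alpha> i)) / Gamma (a + sum \<alpha> J)" for J
  define b where "b = a + sum \<alpha> I"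
  have K_meas [measurable]: "K J s \<in> borel_measurable (\<Pi>\<^sub>M i\<in>J. lborel)" if "finite J" for J s
  proof -
    have [simp, intro]: "countable J"
      using that by (rule countable_finite)
    show ?thesis
      unfolding K_def by measurable
  qed
  have pos: "\<alpha> i > 0" "b > 0"
    using insert.prems assms(2) by (auto simp: b_def intro!: add_pos_nonneg sum_nonneg intro: less_imp_le)
  have G_nonneg: "G I \<ge> 0"
    unfolding G_def using insert.prems assms(2) pos
    by (intro divide_nonneg_nonneg mult_nonneg_nonneg prod_nonneg) (auto intro!: less_imp_le[OF Gamma_real_pos] simp: b_def)
  have K_insert: "K (insert i I) s (\<theta>(i := y)) = of_bool (0 < y) * y powr (\<alpha> i - 1) * K I (s - y) \<theta>" for y \<theta>
  proof -
    have "sum (\<theta>(i := y)) I = sum \<theta> I" "(\<Prod>j\<in>I. (\<theta>(i := y)) j powr (\<alpha> j - 1)) = (\<Prod>j\<in>I. \<theta> j powr (\<alpha> j - 1))"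
      "(\<forall>j\<in>I. 0 < (\<theta>(i := y)) j) = (\<forall>j\<in>I. 0 < \<theta> j)"
      using insert.hyps by (auto intro!: sum.cong prod.cong)
    then show ?thesis
      using insert.hyps by (auto simp: K_def algebra_simps)
  qed
  \<comment> \<open>Tonelli with the new coordinate outermost, so that the induction hypothesis
    applies to the inner integral.\<close>
  have "(\<integral>\<^sup>+\<theta>. ennreal (K (insert i I) s \<theta>) \<partial>(\<Pi>\<^sub>M i\<in>insert i I. lborel))
    = (\<integral>\<^sup>+y. (\<integral>\<^sup>+\<theta>. ennreal (K (insert i I) s (\<theta>(i := y))) \<partial>(\<Pi>\<^sub>M i\<in>I. lborel)) \<partial>lborel)"
    using insert.hyps by (intro product_nn_integral_insert_rev) auto
  also have "\<dots> = (\<integral>\<^sup>+y. ennreal (of_bool (0 < y) * y powr (\<alpha> i - 1)) *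
       (\<integral>\<^sup>+\<theta>. ennreal (K I (s - y) \<theta>) \<partial>(\<Pi>\<^sub>M i\<in>I. lborel)) \<partial>lborel)"
    using insert.hyps by (simp add: K_insert ennreal_mult' nn_integral_cmult)
  also have "\<dots> = (\<integral>\<^sup>+y. ennreal (G I) * ennreal (indicator {0<..<s} y *
       (y powr (\<alpha> i - 1) * (s - y) powr (b - 1))) \<partial>lborel)"
  proof (rule nn_integral_cong, goal_cases)
    case (1 y)
    have "(\<integral>\<^sup>+\<theta>. ennreal (K I (s - y) \<theta>) \<partial>(\<Pi>\<^sub>M i\<in>I. lborel))
       = ennreal (of_bool (y < s) * ((s - y) powr (b - 1) * G I))"
      using insert.IH[of "s - y"] insert.prems by (simp add: K_def b_def G_def)
    then show ?case
      using G_nonneg by (auto simp: mult_ac simp flip: ennreal_mult)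
  qed
  also have "\<dots> = ennreal (G I) * ennreal (indicator {0<..} s * (s powr (\<alpha> i + b - 1) * Beta (\<alpha> i) b))"
    using pos by (simp add: nn_integral_cmult nn_integral_Beta_scaled)
  also have "\<dots> = ennreal (of_bool (0 < s) * (s powr (a + sum \<alpha> (insert i I) - 1) * G (insert i I)))"
  proof -
    \<comment> \<open>The denominator \<open>Gamma b\<close> of \<open>G I\<close> cancels the
      factor \<open>Gamma b\<close> of the Beta function.\<close>
    have "G (insert i I) = G I * Beta (\<alpha> i) b"
      using insert.hyps Gamma_real_pos[OF pos(2), THEN less_imp_neq] by (simp add: G_def b_def Beta_def add_ac)
    moreover have "a + sum \<alpha> (insert i I) = \<alpha> i + b"
      using insert.hyps by (simp add: b_def)
    ultimately show ?thesis
      using G_nonneg by (auto simp: mult_ac simp flip: ennreal_mult')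
  qed
  finally show ?case
    unfolding K_def G_def .
qed

text \<open>The factor \<open>\<theta> i\<close> raises the parameter \<open>\<alpha> i\<close> by
  one, so the mean is a quotient of two normalising constants, evaluated by
  \<open>Gamma (x + 1) = x * Gamma x\<close>.\<close>

lemma Dir_mean_eq:
  assumes i: "i \<in> {1..d}" and \<alpha>: "\<And>j. j \<le> d \<Longrightarrow> \<alpha> j > 0"
  shows "Dir_mean d \<alpha> i = \<alpha> i / (\<Sum>j=0..d. \<alpha> j)"
proof -
  let ?M = "\<Pi>\<^sub>M i\<in>{1..d}. (lborel :: real measure)"
  define \<beta> where "\<beta> = \<alpha>(i := \<alpha> i + 1)"
  define S where "S = (\<Sum>j=0..d. \<alpha> j)"
  have split: "{0..d} = insert 0 {1..d}"
    by auto
  have S_pos: "S > 0"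
    unfolding S_def using \<alpha> by (intro sum_pos) auto
  have S_split: "S = \<alpha> 0 + sum \<alpha> {1..d}"
    unfolding S_def split by simp
  have B_pos: "multi_Beta d \<alpha> > 0"
    unfolding multi_Beta_def using \<alpha> S_pos
    by (auto intro!: divide_pos_pos prod_pos Gamma_real_pos simp: S_def)
  have Gamma_\<beta>: "(\<Prod>j=1..d. Gamma (\<beta> j)) = \<alpha> i * (\<Prod>j=1..d. Gamma (\<alpha> j))"
  proof -
    have "(\<Prod>j=1..d. Gamma (\<beta> j)) = Gamma (\<beta> i) * (\<Prod>j\<in>{1..d}-{i}. Gamma (\<beta> j))"
      using i by (intro prod.remove) auto
    also have "Gamma (\<beta> i) = \<alpha> i * Gamma (\<alpha> i)"
      using \<alpha>[of i] i by (auto simp: \<beta>_def intro!: Gamma_plus1 dest: nonpos_Ints_nonpos)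
    also have "(\<Prod>j\<in>{1..d}-{i}. Gamma (\<beta> j)) = (\<Prod>j\<in>{1..d}-{i}. Gamma (\<alpha> j))"
      by (intro prod.cong) (auto simp: \<beta>_def)
    also have "\<alpha> i * Gamma (\<alpha> i) * \<dots> = \<alpha> i * (\<Prod>j=1..d. Gamma (\<alpha> j))"
      using i by (subst (2) prod.remove[of _ i]) auto
    finally show ?thesis .
  qed
  have sum_\<beta>: "sum \<beta> {1..d} = sum \<alpha> {1..d} + 1"
  proof -
    have "sum \<beta> {1..d} = \<beta> i + sum \<beta> ({1..d}-{i})"
      using i by (intro sum.remove) auto
    also have "sum \<beta> ({1..d}-{i}) = sum \<alpha> ({1..d}-{i})"
      by (intro sum.cong) (auto simp: \<beta>_def)
    finally show ?thesis
      using i by (simp add: \<beta>_def sum.remove[of _ i \<alpha>])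
  qed
  \<comment> \<open>The bounds \<open>\<theta> j < 1\<close> and
    \<open>0 < sum \<theta> {1..d}\<close> in \<open>open_simplex\<close> follow from positivity and
    \<open>sum \<theta> {1..d} < 1\<close>, so its indicator agrees with the one in
    \<open>nn_integral_simplex\<close>.\<close>
  have density: "Dir_density d \<alpha> \<theta> * \<theta> i = 1 / multi_Beta d \<alpha> *
      (of_bool ((\<forall>j\<in>{1..d}. 0 < \<theta> j) \<and> sum \<theta> {1..d} < 1) *
        ((1 - sum \<theta> {1..d}) powr (\<alpha> 0 - 1) * (\<Prod>j=1..d. \<theta> j powr (\<beta> j - 1))))"
    if "\<theta> \<in> space ?M" for \<theta>
  proof (cases "(\<forall>j\<in>{1..d}. 0 < \<theta> j) \<and> sum \<theta> {1..d} < 1")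
    case True
    have "\<theta> j < 1" if "j \<in> {1..d}" for j
    proof -
      have "\<theta> j \<le> sum \<theta> {1..d}"
        using True that by (intro member_le_sum) (auto intro: less_imp_le)
      with True show ?thesis
        by simp
    qed
    moreover have "0 < sum \<theta> {1..d}"
      using True i by (intro sum_pos) auto
    ultimately have "\<theta> \<in> open_simplex d"
      using True that by (auto simp: open_simplex_def space_PiM PiE_def)
    moreover have "(\<Prod>j=1..d. \<theta> j powr (\<beta> j - 1)) = (\<Prod>j=1..d. \<theta> j powr (\<alpha> j - 1)) * \<theta> i"
    proof -
      have "(\<Prod>j=1..d. \<theta> j powr (\<beta> j - 1)) = (\<Prod>j=1..d. \<theta> j powr (\<alpha> j - 1) * (if j = i then \<theta> i else 1))"
        using True powr_mult_base[of "\<theta> i" "\<alpha> i - 1"] i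
        by (intro prod.cong) (auto simp: \<beta>_def mult.commute less_imp_le)
      then show ?thesis
        using i by (simp add: prod.distrib)
    qed
    ultimately show ?thesis
      using True by (simp add: Dir_density_def)
  next
    case False
    then have "\<theta> \<notin> open_simplex d"
      by (auto simp: open_simplex_def)
    then show ?thesis
      using False by (auto simp: Dir_density_def)
  qed
  have density_nonneg: "Dir_density d \<alpha> \<theta> \<ge> 0" for \<theta>
    using B_pos by (auto simp: Dir_density_def indicator_def intro!: divide_nonneg_pos mult_nonneg_nonneg prod_nonneg)
  have "Dir_mean d \<alpha> i = (\<integral>\<theta>. Dir_density d \<alpha> \<theta> * \<theta> i \<partial>?M)"
    unfolding Dir_mean_def Dir_marginal_eq_density using density_nonneg i
    by (subst integral_density) (auto simp del: One_nat_def)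
  also have "\<dots> = (\<integral>\<theta>. 1 / multi_Beta d \<alpha> *
      (of_bool ((\<forall>j\<in>{1..d}. 0 < \<theta> j) \<and> sum \<theta> {1..d} < 1) *
        ((1 - sum \<theta> {1..d}) powr (\<alpha> 0 - 1) * (\<Prod>j=1..d. \<theta> j powr (\<beta> j - 1)))) \<partial>?M)"
    by (intro Bochner_Integration.integral_cong density) auto
  also have "\<dots> = 1 / multi_Beta d \<alpha> * (\<integral>\<theta>.
      (of_bool ((\<forall>j\<in>{1..d}. 0 < \<theta> j) \<and> sum \<theta> {1..d} < 1) *
        ((1 - sum \<theta> {1..d}) powr (\<alpha> 0 - 1) * (\<Prod>j=1..d. \<theta> j powr (\<beta> j - 1)))) \<partial>?M)"
    by simp
  also have "(\<integral>\<theta>.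
      (of_bool ((\<forall>j\<in>{1..d}. 0 < \<theta> j) \<and> sum \<theta> {1..d} < 1) *
        ((1 - sum \<theta> {1..d}) powr (\<alpha> 0 - 1) * (\<Prod>j=1..d. \<theta> j powr (\<beta> j - 1)))) \<partial>?M)
     = Gamma (\<alpha> 0) * (\<Prod>j=1..d. Gamma (\<beta> j)) / Gamma (\<alpha> 0 + sum \<beta> {1..d})"
  proof (subst integral_eq_nn_integral, goal_cases)
    case 3
    have *: "\<beta> j > 0" if "j \<in> {1..d}" for j
      using \<alpha>[of j] that by (auto simp: \<beta>_def)
    then have "Gamma (\<alpha> 0) * (\<Prod>j=1..d. Gamma (\<beta> j)) / Gamma (\<alpha> 0 + sum \<beta> {1..d}) \<ge> 0"
      using \<alpha>[of 0] S_pos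
      by (intro divide_nonneg_nonneg mult_nonneg_nonneg prod_nonneg less_imp_le[OF Gamma_real_pos])
        (auto simp: sum_\<beta> S_split simp del: One_nat_def)
    with * show ?case
      using \<alpha>[of 0] by (subst nn_integral_simplex) auto
  qed (auto intro!: AE_I2 mult_nonneg_nonneg prod_nonneg)
  also have "\<alpha> 0 + sum \<beta> {1..d} = S + 1"
    by (simp add: sum_\<beta> S_split del: One_nat_def)
  also have "Gamma (S + 1) = S * Gamma S"
    using S_pos by (auto intro!: Gamma_plus1 dest: nonpos_Ints_nonpos)
  also have "1 / multi_Beta d \<alpha> * (Gamma (\<alpha> 0) * (\<Prod>j=1..d. Gamma (\<beta> j)) / (S * Gamma S)) = \<alpha> i / S"
  proof -
    have "multi_Beta d \<alpha> = Gamma (\<alpha> 0) * (\<Prod>j=1..d. Gamma (\<alpha> j)) / Gamma S"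
      unfolding multi_Beta_def S_def split by simp
    then have "Gamma (\<alpha> 0) * (\<Prod>j=1..d. Gamma (\<beta> j)) = \<alpha> i * (Gamma S * multi_Beta d \<alpha>)"
      using Gamma_real_pos[OF S_pos, THEN less_imp_neq] by (simp add: Gamma_\<beta> del: One_nat_def)
    then show ?thesis
      using B_pos Gamma_real_pos[OF S_pos, THEN less_imp_neq] S_pos by (simp del: One_nat_def)
  qed
  finally show ?thesis
    by (simp add: S_def)
qed

section \<open>Matrix inverses, partial derivatives and Gibbs' inequality\<close>

text \<open>Two-sided inverses are unique by \<open>B' = B' (A B) = (B' A) B = B\<close>, and the
  zero padding fixes the remaining entries.\<close>

lemma minv_eqI:
  assumes AB: "\<And>i k. i \<in> {1..d} \<Longrightarrow> k \<in> {1..d} \<Longrightarrow> (\<Sum>j=1..d. A i j * B j k) = (if i = k then 1 else 0)"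
    and BA: "\<And>i k. i \<in> {1..d} \<Longrightarrow> k \<in> {1..d} \<Longrightarrow> (\<Sum>j=1..d. B i j * A j k) = (if i = k then 1 else 0)"
    and 0: "\<And>i j. i \<notin> {1..d} \<or> j \<notin> {1..d} \<Longrightarrow> B i j = 0"
  shows "minv d A = B"
  unfolding minv_def
proof (rule the_equality, goal_cases)
  case 1
  then show ?case
    using assms by blast
next
  case (2 B')
  show ?case
  proof (intro ext)
    fix i k
    show "B' i k = B i k"
    proof (cases "i \<in> {1..d} \<and> k \<in> {1..d}")
      case True
      have "B' i k = (\<Sum>j=1..d. B' i j * (if j = k then 1 else 0))"
        using True by (simp add: if_distrib cong: if_cong)
      also have "\<dots> = (\<Sum>j=1..d. B' i j * (\<Sum>l=1..d. A j l * B l k))"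
        using True by (intro sum.cong refl, subst AB) auto
      also have "\<dots> = (\<Sum>l=1..d. (\<Sum>j=1..d. B' i j * A j l) * B l k)"
        unfolding sum_distrib_left sum_distrib_right by (subst sum.swap) (simp add: mult_ac)
      also have "\<dots> = (\<Sum>l=1..d. (if i = l then 1 else 0) * B l k)"
        using True 2 by (intro sum.cong) auto
      also have "\<dots> = B i k"
        using True by (simp add: if_distrib[of "\<lambda>x. x * _"] cong: if_cong)
      finally show ?thesis .
    qed (use 0 2 in auto)
  qed
qed

section \<open>Partial derivatives of the potential up to third order\<close>

text \<open>These conditions keep the argument of every logarithm positive and survive small changes
  of one coordinate in \<open>{1..d}\<close>.\<close>

definition coord_simplex :: "nat \<Rightarrow> (nat \<Rightarrow> real) set" where
  "coord_simplex d = {x. (\<forall>j\<in>{1..d}. 0 < x j) \<and> (\<Sum>j=1..d. x j) < 1}"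

lemma sum_fun_upd:
  fixes x :: "'a \<Rightarrow> 'b::comm_monoid_add"
  assumes "finite A" "i \<in> A"
  shows "sum (x(i := t)) A = t + sum x (A - {i})"
proof -
  have "sum (x(i := t)) A = (x(i := t)) i + sum (x(i := t)) (A - {i})"
    using assms by (rule sum.remove)
  also have "sum (x(i := t)) (A - {i}) = sum x (A - {i})"
    by (intro sum.cong) auto
  finally show ?thesis
    by simp
qed

text \<open>A derivative sees only nearby values, and the simplex is open along coordinate
  \<open>i\<close>. This allows a formula valid only on the simplex to be differentiated
  again.\<close>

lemma partial_cong:
  assumes x: "x \<in> coord_simplex d" and i: "i \<in> {1..d}"
    and eq: "\<And>y. y \<in> coord_simplex d \<Longrightarrow> f y = g y"
  shows "partial i f x = partial i g x"
  unfolding partial_def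
proof (rule deriv_cong_ev)
  have "x i > 0" "x i < 1 - sum x ({1..d} - {i})"
    using x i sum_fun_upd[of "{1..d}" i x "x i"] by (auto simp: coord_simplex_def)
  then have "\<forall>\<^sub>F t in nhds (x i). t > 0" "\<forall>\<^sub>F t in nhds (x i). t < 1 - sum x ({1..d} - {i})"
    by (auto intro: order_tendstoD[OF filterlim_ident])
  then show "\<forall>\<^sub>F t in nhds (x i). f (x(i := t)) = g (x(i := t))"
  proof eventually_elim
    case (elim t)
    then have "x(i := t) \<in> coord_simplex d"
      using x i sum_fun_upd[of "{1..d}" i x t] by (auto simp: coord_simplex_def)
    then show ?case
      by (rule eq)
  qed
qed simp

text \<open>Along coordinate \<open>k\<close> only \<open>ln (x k)\<close> and the logarithm of the
  slack vary; \<open>c\<close> collects the other coordinates.\<close>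

lemma partial_V_pot:
  assumes x: "x \<in> coord_simplex d" and k: "k \<in> {1..d}"
  shows "partial k (V_pot d N) x =
    real (total_count d N) * (freq d N 0 / (1 - (\<Sum>j=1..d. x j)) - freq d N k / x k)"
proof -
  define c where "c = sum x ({1..d} - {k})"
  have s: "(\<Sum>j=1..d. x j) = x k + c"
    using k unfolding c_def by (intro sum.remove) auto
  have pos: "x k > 0" "x k + c < 1"
    using x k s by (auto simp: coord_simplex_def)
  have V: "V_pot d N (x(k := t)) = real (total_count d N) *
      (- freq d N 0 * ln (1 - (t + c)) -
        (freq d N k * ln t + (\<Sum>j\<in>{1..d} - {k}. freq d N j * ln (x j))))" for t
  proof -
    have "(\<Sum>j=1..d. freq d N j * ln ((x(k := t)) j)) =
        freq d N k * ln t + (\<Sum>j\<in>{1..d} - {k}. freq d N j * ln ((x(k := t)) j))"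
      using k by (subst sum.remove[of _ k]) auto
    also have "(\<Sum>j\<in>{1..d} - {k}. freq d N j * ln ((x(k := t)) j)) =
        (\<Sum>j\<in>{1..d} - {k}. freq d N j * ln (x j))"
      by (intro sum.cong) auto
    finally show ?thesis
      using sum_fun_upd[of "{1..d}" k x t] k by (simp add: V_pot_def v_pot_def c_def)
  qed
  show ?thesis
    unfolding partial_def V
    unfolding s using pos by (intro DERIV_imp_deriv) (auto intro!: derivative_eq_intros simp: field_simps)
qed

text \<open>The slack term contributes a rank-one matrix with equal entries, the other logarithms a
  diagonal one.\<close>

lemma hess_V_pot:
  assumes x: "x \<in> coord_simplex d" and i: "i \<in> {1..d}" and k: "k \<in> {1..d}"
  shows "hess (V_pot d N) x i k = real (total_count d N) *
    (freq d N 0 / (1 - (\<Sum>j=1..d. x j))\<^sup>2 + (if i = k then freq d N k / (x k)\<^sup>2 else 0))"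
proof -
  define c where "c = sum x ({1..d} - {i})"
  have s: "(\<Sum>j=1..d. x j) = x i + c"
    using i unfolding c_def by (intro sum.remove) auto
  have pos: "x k > 0" "x i + c < 1"
    using x k s by (auto simp: coord_simplex_def)
  have "hess (V_pot d N) x i k = partial i (\<lambda>x. real (total_count d N) *
      (freq d N 0 / (1 - (\<Sum>j=1..d. x j)) - freq d N k / x k)) x"
    unfolding hess_def using x i partial_V_pot k by (intro partial_cong) auto
  also have "\<dots> = deriv (\<lambda>t. real (total_count d N) *
      (freq d N 0 / (1 - (t + c)) - freq d N k / (if k = i then t else x k))) (x i)"
    unfolding partial_def sum_fun_upd[OF finite_atLeastAtMost i] by (simp add: c_def)
  also have "\<dots> = real (total_count d N) *
    (freq d N 0 / (1 - (\<Sum>j=1..d. x j))\<^sup>2 + (if i = k then freq d N k / (x k)\<^sup>2 else 0))"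
    unfolding s using pos by (intro DERIV_imp_deriv, cases "i = k")
      (auto intro!: derivative_eq_intros simp: power2_eq_square)
  finally show ?thesis .
qed

lemma has_real_derivative_divide_power2:
  assumes "(g has_real_derivative D) (at y)" "g y \<noteq> 0"
  shows "((\<lambda>t. a / (g t)\<^sup>2) has_real_derivative - (2 * a * D / g y ^ 3)) (at y)"
  by (rule derivative_eq_intros assms refl)+
    (use assms(2) in \<open>auto simp: power2_eq_square power3_eq_cube divide_simps\<close>)

text \<open>The slack term again contributes equally to all entries and the rest only to the
  diagonal \<open>l = i = k\<close>; the signs differ because the slack decreases in each
  coordinate.\<close>

lemma third_V_pot:
  assumes x: "x \<in> coord_simplex d" and i: "i \<in> {1..d}" and k: "k \<in> {1..d}" and l: "l \<in> {1..d}"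
  shows "third (V_pot d N) x l i k = 2 * real (total_count d N) *
    (freq d N 0 / (1 - (\<Sum>j=1..d. x j)) ^ 3 - (if l = i \<and> i = k then freq d N k / x k ^ 3 else 0))"
proof -
  define c where "c = sum x ({1..d} - {l})"
  have s: "(\<Sum>j=1..d. x j) = x l + c"
    using l unfolding c_def by (intro sum.remove) auto
  have pos: "x k > 0" "x l + c < 1"
    using x k s by (auto simp: coord_simplex_def)
  have "third (V_pot d N) x l i k = partial l (\<lambda>x. real (total_count d N) *
      (freq d N 0 / (1 - (\<Sum>j=1..d. x j))\<^sup>2 + (if i = k then freq d N k / (x k)\<^sup>2 else 0))) x"
    unfolding third_def using x l hess_V_pot[OF _ i k, unfolded hess_def] by (intro partial_cong) auto
  also have "\<dots> = deriv (\<lambda>t. real (total_count d N) *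
      (freq d N 0 / (1 - (t + c))\<^sup>2 +
        (if i = k then freq d N k / (if k = l then t else x k)\<^sup>2 else 0))) (x l)"
    unfolding partial_def sum_fun_upd[OF finite_atLeastAtMost l] by (simp add: c_def cong: if_cong)
  also have "\<dots> = 2 * real (total_count d N) *
    (freq d N 0 / (1 - (\<Sum>j=1..d. x j)) ^ 3 - (if l = i \<and> i = k then freq d N k / x k ^ 3 else 0))"
  proof (intro DERIV_imp_deriv)
    have g: "((\<lambda>t. 1 - (t + c)) has_real_derivative -1) (at (x l))"
      by (auto intro!: derivative_eq_intros)
    have *: "((\<lambda>t. freq d N 0 / (1 - (t + c))\<^sup>2) has_real_derivative
        2 * freq d N 0 / (1 - (x l + c)) ^ 3) (at (x l))"
      using has_real_derivative_divide_power2[OF g, of "freq d N 0"] pos by simp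
    have **: "((\<lambda>t. if i = k then freq d N k / (if k = l then t else x k)\<^sup>2 else 0) has_real_derivative
        (if l = i \<and> i = k then - (2 * freq d N k / x k ^ 3) else 0)) (at (x l))"
      using has_real_derivative_divide_power2[of "\<lambda>t. t" 1 "x l" "freq d N k"] pos
      by (cases "i = k"; cases "k = l") auto
    show "((\<lambda>t. real (total_count d N) * (freq d N 0 / (1 - (t + c))\<^sup>2 +
        (if i = k then freq d N k / (if k = l then t else x k)\<^sup>2 else 0))) has_real_derivative
      2 * real (total_count d N) *
        (freq d N 0 / (1 - (\<Sum>j=1..d. x j)) ^ 3 - (if l = i \<and> i = k then freq d N k / x k ^ 3 else 0)))
      (at (x l))"
      unfolding s by (rule DERIV_cong[OF DERIV_cmult[OF DERIV_add[OF * **]]]) (auto simp: algebra_simps)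
  qed
  finally show ?thesis .
qed

text \<open>Apply \<open>ln x\<close> \<le> \<open>x - 1\<close> at \<open>x = q j / p j\<close>,
  weight by \<open>p j\<close> and sum: the linear terms cancel because the totals agree. Equality
  holds only at \<open>x = 1\<close>, so one differing index makes the sum strict.\<close>

lemma gibbs_strict:
  fixes p q :: "'a \<Rightarrow> real"
  assumes "finite A" and pos: "\<And>j. j \<in> A \<Longrightarrow> p j > 0" "\<And>j. j \<in> A \<Longrightarrow> q j > 0"
    and "sum q A = sum p A" and "\<exists>j\<in>A. q j \<noteq> p j"
  shows "(\<Sum>j\<in>A. p j * ln (q j)) < (\<Sum>j\<in>A. p j * ln (p j))"
proof -
  have *: "p j * ln (q j) = p j * ln (p j) + p j * ln (q j / p j)" if "j \<in> A" for j
    using pos[OF that] by (simp add: ln_div algebra_simps)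
  have **: "p j * (q j / p j - 1) = q j - p j" if "j \<in> A" for j
    using pos[OF that] by (simp add: field_simps)
  have "(\<Sum>j\<in>A. p j * ln (q j)) < (\<Sum>j\<in>A. p j * ln (p j) + (q j - p j))"
  proof (intro sum_strict_mono_ex1)
    show "\<forall>j\<in>A. p j * ln (q j) \<le> p j * ln (p j) + (q j - p j)"
    proof
      fix j assume j: "j \<in> A"
      then have "p j * ln (q j / p j) \<le> p j * (q j / p j - 1)"
        using pos by (intro mult_left_mono ln_le_minus_one) (auto simp: less_imp_le)
      then show "p j * ln (q j) \<le> p j * ln (p j) + (q j - p j)"
        using * ** j by simp
    qed
    obtain j where j: "j \<in> A" "q j \<noteq> p j"
      using assms by blast
    then have "ln (q j / p j) \<noteq> q j / p j - 1"
      using pos[of j] ln_eq_minus_one[of "q j / p j"] by auto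
    then have "ln (q j / p j) < q j / p j - 1"
      using pos[of j] j ln_le_minus_one[of "q j / p j"] by auto
    then have "p j * ln (q j / p j) < p j * (q j / p j - 1)"
      using pos[of j] j by (intro mult_strict_left_mono) auto
    then have "p j * ln (q j) < p j * ln (p j) + (q j - p j)"
      using * ** j by simp
    with j show "\<exists>j\<in>A. p j * ln (q j) < p j * ln (p j) + (q j - p j)"
      by blast
  qed (fact assms)
  also have "\<dots> = (\<Sum>j\<in>A. p j * ln (p j))"
    using assms by (simp add: sum.distrib sum_subtractf)
  finally show ?thesis .
qed

section \<open>The multinomial model with positive counts\<close>

locale positive_counts =
  fixes d :: nat and N :: "nat \<Rightarrow> nat"
  assumes d_pos: "d \<ge> 1" and freq_pos: "\<And>j. j \<le> d \<Longrightarrow> freq d N j > 0"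
begin

abbreviation n :: real where "n \<equiv> real (total_count d N)"
abbreviation p :: "nat \<Rightarrow> real" where "p \<equiv> freq d N"

text \<open>For \<open>n = 0\<close>, division by zero would make every frequency
  \<open>0\<close>.\<close>

lemma n_pos: "n > 0"
  using freq_pos[of 0] by (cases "total_count d N") (auto simp: freq_def)

lemma n_freq: "n * p j = real (N j)"
  using n_pos by (simp add: freq_def)

lemma n_eq: "n = (\<Sum>j=0..d. real (N j))"
  by (simp add: total_count_def)

lemma sum_freq: "(\<Sum>j=0..d. p j) = 1"
  unfolding freq_def sum_divide_distrib[symmetric] n_eq[symmetric] using n_pos by simp

lemma sum_split_0: "(\<Sum>j=0..d. f j) = f 0 + (\<Sum>j=1..d. f j)" for f :: "nat \<Rightarrow> real"
  by (simp add: sum.atLeast_Suc_atMost)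

lemma sum_freq_tail: "(\<Sum>j=1..d. p j) = 1 - p 0"
  using sum_freq by (simp add: sum_split_0)

lemma sum_p_pt: "(\<Sum>j=1..d. p_pt d N j) = 1 - p 0"
  using sum_freq_tail by (simp add: p_pt_def)

lemma p_pt_coord_simplex: "p_pt d N \<in> coord_simplex d"
  using sum_p_pt freq_pos by (auto simp: coord_simplex_def p_pt_def)

lemma p_pt_open_simplex: "p_pt d N \<in> open_simplex d"
proof -
  have "p_pt d N j < 1" if "j \<in> {1..d}" for j
  proof -
    have "p_pt d N j \<le> (\<Sum>j=1..d. p_pt d N j)"
      using that freq_pos by (intro member_le_sum) (auto simp: p_pt_def less_imp_le)
    then show ?thesis
      using sum_p_pt freq_pos[of 0] by simp
  qed
  moreover have "0 < (\<Sum>j=1..d. p_pt d N j)"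
    using d_pos freq_pos by (intro sum_pos) (auto simp: p_pt_def)
  ultimately show ?thesis
    using p_pt_coord_simplex by (auto simp: open_simplex_def coord_simplex_def p_pt_def)
qed

section \<open>The mode and the mean\<close>

text \<open>Adjoining the slack as coordinate \<open>0\<close> turns \<theta> into a probability
  vector \<open>q\<close> with \<open>v_pot d N \<theta> = - (\<Sum>j=0..d. p j * ln (q j))\<close>,
  to which Gibbs' inequality applies.\<close>

lemma V_pot_strict_min:
  assumes \<theta>: "\<theta> \<in> open_simplex d" and "\<theta> \<noteq> p_pt d N"
  shows "V_pot d N (p_pt d N) < V_pot d N \<theta>"
proof -
  define q where "q = \<theta>(0 := 1 - (\<Sum>j=1..d. \<theta> j))"
  \<comment> \<open>Both points are extensional, so being different functions they differ at a
    relevant index.\<close>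
  have "\<exists>j\<in>{1..d}. \<theta> j \<noteq> p j"
  proof (rule ccontr)
    assume "\<not> ?thesis"
    then have "\<theta> = p_pt d N"
      using \<theta> by (intro extensionalityI[of _ "{1..d}"]) (auto simp: open_simplex_def p_pt_def)
    with assms show False
      by simp
  qed
  then obtain j where "j \<in> {1..d}" "\<theta> j \<noteq> p j"
    by blast
  then have "\<exists>j\<in>{0..d}. q j \<noteq> p j"
    by (intro bexI[of _ j]) (auto simp: q_def)
  moreover have "q j > 0" if "j \<in> {0..d}" for j
    using \<theta> that by (auto simp: q_def open_simplex_def)
  moreover have "sum q {0..d} = sum p {0..d}"
    using sum_freq unfolding sum_split_0 by (simp add: q_def)
  ultimately have "(\<Sum>j=0..d. p j * ln (q j)) < (\<Sum>j=0..d. p j * ln (p j))"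
    using freq_pos by (intro gibbs_strict) auto
  then have "v_pot d N (p_pt d N) < v_pot d N \<theta>"
    unfolding v_pot_def sum_p_pt unfolding sum_split_0 by (simp add: q_def p_pt_def)
  then show ?thesis
    using n_pos by (simp add: V_pot_def)
qed

lemma Dir_density_eq:
  assumes \<theta>: "\<theta> \<in> open_simplex d"
  shows "Dir_density d (\<lambda>j. real (N j) + 1) \<theta> = exp (- V_pot d N \<theta>) / multi_Beta d (\<lambda>j. real (N j) + 1)"
proof -
  have "(\<Prod>j=1..d. \<theta> j powr real (N j)) = exp (\<Sum>j=1..d. real (N j) * ln (\<theta> j))"
    unfolding exp_sum[OF finite_atLeastAtMost]
    using \<theta> by (intro prod.cong refl) (force simp: powr_def open_simplex_def)
  then have "(1 - (\<Sum>j=1..d. \<theta> j)) powr real (N 0) * (\<Prod>j=1..d. \<theta> j powr real (N j)) =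
      exp (real (N 0) * ln (1 - (\<Sum>j=1..d. \<theta> j)) + (\<Sum>j=1..d. real (N j) * ln (\<theta> j)))"
    using \<theta> by (simp add: powr_def open_simplex_def exp_add)
  also have "real (N 0) * ln (1 - (\<Sum>j=1..d. \<theta> j)) + (\<Sum>j=1..d. real (N j) * ln (\<theta> j)) = - V_pot d N \<theta>"
    by (simp add: V_pot_def v_pot_def algebra_simps sum_distrib_left flip: n_freq)
  finally show ?thesis
    using \<theta> by (simp add: Dir_density_def)
qed

text \<open>The density is a positive multiple of \<open>exp (- V_pot d N \<theta>)\<close>, so the
  strict minimum is its unique maximiser; uniqueness resolves the description in
  \<open>Dir_mode\<close>.\<close>

lemma Dir_mode_eq: "Dir_mode d (\<lambda>j. real (N j) + 1) = p_pt d N"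
proof -
  have "multi_Beta d (\<lambda>j. real (N j) + 1) > 0"
    unfolding multi_Beta_def
    by (intro divide_pos_pos prod_pos Gamma_real_pos sum_pos) (auto intro: add_nonneg_pos)
  then have *: "Dir_density d (\<lambda>j. real (N j) + 1) \<theta> < Dir_density d (\<lambda>j. real (N j) + 1) (p_pt d N)"
    if "\<theta> \<in> open_simplex d" "\<theta> \<noteq> p_pt d N" for \<theta>
    using V_pot_strict_min that by (simp add: Dir_density_eq p_pt_open_simplex divide_strict_right_mono)
  show ?thesis
    unfolding Dir_mode_def is_arg_max_def
    using * p_pt_open_simplex by (intro the_equality) (metis less_asym)+
qed

lemma Dir_mean_counts:
  assumes "i \<in> {1..d}"
  shows "Dir_mean d (\<lambda>j. real (N j) + 1) i = (n * p i + 1) / (n + real d + 1)"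
proof -
  have "(\<Sum>j=0..d. real (N j) + 1) = n + real d + 1"
    by (simp add: n_eq sum.distrib)
  then show ?thesis
    using assms by (subst Dir_mean_eq) (auto simp: n_freq intro: add_nonneg_pos)
qed

section \<open>The Hessian at the mode, its inverse and the skew correction\<close>

lemma H_V_eq:
  assumes "i \<in> {1..d}" "k \<in> {1..d}"
  shows "H_V d N i k = n * (1 / p 0 + (if i = k then 1 / p k else 0))"
  unfolding H_V_def hess_V_pot[OF p_pt_coord_simplex assms] sum_p_pt
  using assms freq_pos[of 0] freq_pos[of k] by (simp add: p_pt_def power2_eq_square)

text \<open>The inverse of \<open>H_V\<close>: the covariance matrix of the empirical frequencies in
  \<open>n\<close> draws from \<open>p\<close>, padded with zeros as in \<open>minv\<close>.\<close>

definition cov :: "nat \<Rightarrow> nat \<Rightarrow> real" where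
  "cov i j = (if i \<in> {1..d} \<and> j \<in> {1..d} then ((if i = j then p i else 0) - p i * p j) / n else 0)"

lemma cov_sym: "cov i j = cov j i"
  by (simp add: cov_def)

text \<open>Covariances with all frequencies \<open>0..d\<close> sum to zero, so this is minus the
  covariance with frequency \<open>0\<close>.\<close>

lemma sum_cov:
  assumes "i \<in> {1..d}"
  shows "(\<Sum>j=1..d. cov i j) = p i * p 0 / n"
proof -
  have "(\<Sum>j=1..d. cov i j) = (\<Sum>j=1..d. (if i = j then p i else 0) - p i * p j) / n"
    unfolding sum_divide_distrib using assms by (intro sum.cong) (auto simp: cov_def)
  also have "(\<Sum>j=1..d. (if i = j then p i else 0) - p i * p j) = p i - p i * (1 - p 0)"
    using assms by (simp add: sum_subtractf del: One_nat_def flip: sum_distrib_left sum_freq_tail)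
  finally show ?thesis
    by (simp add: algebra_simps)
qed

text \<open>The rank-one part of \<open>H_V\<close> meets only the sum of row \<open>k\<close> of
  \<open>cov\<close>, giving \<open>p k\<close>; the diagonal part rescales \<open>cov i k\<close>
  by \<open>n / p i\<close>, which cancels this \<open>p k\<close> and leaves the identity.\<close>

lemma H_V_cov:
  assumes "i \<in> {1..d}" "k \<in> {1..d}"
  shows "(\<Sum>j=1..d. H_V d N i j * cov j k) = (if i = k then 1 else 0)"
proof -
  have "(\<Sum>j=1..d. H_V d N i j * cov j k) =
      (\<Sum>j=1..d. n / p 0 * cov k j + (if i = j then n / p i * cov i k else 0))"
    using assms by (intro sum.cong) (auto simp: H_V_eq cov_sym[of k] algebra_simps)
  also have "\<dots> = n / p 0 * (p k * p 0 / n) + n / p i * cov i k"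
    using assms by (simp add: sum.distrib sum_cov[symmetric] sum_distrib_left del: One_nat_def)
  also have "\<dots> = (if i = k then 1 else 0)"
    using assms n_pos freq_pos[of 0] freq_pos[of i] by (auto simp: cov_def field_simps)
  finally show ?thesis .
qed

lemma minv_H_V: "minv d (hess (V_pot d N) (p_pt d N)) = cov"
  unfolding H_V_def[symmetric]
proof (rule minv_eqI)
  fix i k assume ik: "i \<in> {1..d}" "k \<in> {1..d}"
  \<comment> \<open>Both matrices are symmetric, so the left inverse property is the transposed
    right one.\<close>
  have "(\<Sum>j=1..d. cov i j * H_V d N j k) = (\<Sum>j=1..d. H_V d N k j * cov j i)"
    using ik by (intro sum.cong) (auto simp: H_V_eq cov_sym[of i])
  then show "(\<Sum>j=1..d. cov i j * H_V d N j k) = (if i = k then 1 else 0)"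
    using ik by (auto simp: H_V_cov simp del: One_nat_def)
qed (fact H_V_cov, auto simp: cov_def)

text \<open>At \<open>p\<close> the cubes cancel to squares. The constant part then sees the total
  \<open>(1 - p 0) * p 0 / n\<close> of \<open>cov\<close>, giving
  \<open>2 * (1 - p 0) / p 0\<close>; the diagonal part sees \<open>cov l l\<close>, giving
  \<open>2 * (1 - p l) / p l\<close>.\<close>

lemma third_contract_cov:
  assumes l: "l \<in> {1..d}"
  shows "(\<Sum>j=1..d. \<Sum>k=1..d. third (V_pot d N) (p_pt d N) l j k * cov j k) = 2 / p 0 - 2 / p l"
proof -
  have third: "third (V_pot d N) (p_pt d N) l j k =
      2 * n / (p 0)\<^sup>2 - (if j = l then if k = l then 2 * n / (p l)\<^sup>2 else 0 else 0)"
    if "j \<in> {1..d}" "k \<in> {1..d}" for j k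
    unfolding third_V_pot[OF p_pt_coord_simplex that l] sum_p_pt
    using that freq_pos[of 0] freq_pos[of k]
    by (auto simp: p_pt_def power2_eq_square power3_eq_cube field_simps)
  have "(\<Sum>j=1..d. \<Sum>k=1..d. third (V_pot d N) (p_pt d N) l j k * cov j k) =
     (\<Sum>j=1..d. 2 * n / (p 0)\<^sup>2 * (\<Sum>k=1..d. cov j k) -
        (if j = l then \<Sum>k=1..d. (if k = l then 2 * n / (p l)\<^sup>2 * cov l l else 0) else 0))"
  proof (intro sum.cong refl, goal_cases)
    case (1 j)
    have "(\<Sum>k=1..d. third (V_pot d N) (p_pt d N) l j k * cov j k) =
       (\<Sum>k=1..d. 2 * n / (p 0)\<^sup>2 * cov j k - (if j = l then if k = l then 2 * n / (p l)\<^sup>2 * cov l l else 0 else 0))"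
      using 1 by (intro sum.cong) (auto simp: third left_diff_distrib)
    then show ?case
      by (auto simp: sum_subtractf sum_distrib_left)
  qed
  also have "\<dots> = 2 * n / (p 0)\<^sup>2 * (\<Sum>j=1..d. p j * p 0 / n) - 2 * n / (p l)\<^sup>2 * cov l l"
    using l by (simp add: sum_subtractf sum_cov sum_distrib_left del: One_nat_def)
  also have "(\<Sum>j=1..d. p j * p 0 / n) = (1 - p 0) * p 0 / n"
    by (simp add: del: One_nat_def flip: sum_freq_tail sum_divide_distrib sum_distrib_right)
  also have "2 * n / (p 0)\<^sup>2 * \<dots> - 2 * n / (p l)\<^sup>2 * cov l l = 2 / p 0 - 2 / p l"
    using l n_pos freq_pos[of 0] freq_pos[of l]
    by (simp add: cov_def power2_eq_square field_simps)
  finally show ?thesis .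
qed

text \<open>The part \<open>2 / p 0\<close> needs only a row sum of \<open>cov\<close>. In the other
  part \<open>cov i l / p l\<close> is \<open>- p i / n\<close> plus \<open>1 / n\<close> if
  \<open>i = l\<close>, so summing over the \<open>d\<close> values of \<open>l\<close> produces the
  factor \<open>real d\<close>.\<close>

lemma skew_correction_eq:
  assumes i: "i \<in> {1..d}"
  shows "skew_correction d (V_pot d N) (p_pt d N) i = 1 / n * (1 - (real d + 1) * p i)"
proof -
  have "(\<Sum>l=1..d. cov i l * (\<Sum>j=1..d. \<Sum>k=1..d. third (V_pot d N) (p_pt d N) l j k * cov j k)) =
      (\<Sum>l=1..d. 2 / p 0 * cov i l - 2 * ((if i = l then 1 / n else 0) - p i / n))"
  proof (intro sum.cong refl, goal_cases)
    case (1 l)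
    have "cov i l / p l = (if i = l then 1 / n else 0) - p i / n"
      using 1 i n_pos freq_pos[of l] by (auto simp: cov_def field_simps)
    moreover have "cov i l * (2 / p 0 - 2 / p l) = 2 / p 0 * cov i l - 2 * (cov i l / p l)"
      by (simp add: right_diff_distrib mult.commute)
    ultimately show ?case
      using 1 by (simp only: third_contract_cov)
  qed
  also have "\<dots> = 2 / p 0 * (p i * p 0 / n) - 2 * (1 / n - real d * (p i / n))"
    using i unfolding sum_subtractf sum_distrib_left[symmetric] sum_cov[OF i] by simp
  also have "\<dots> = - 2 * (1 / n * (1 - (real d + 1) * p i))"
    using n_pos freq_pos[of 0] by (simp add: field_simps)
  finally have contraction: "(\<Sum>l=1..d. cov i l *
      (\<Sum>j=1..d. \<Sum>k=1..d. third (V_pot d N) (p_pt d N) l j k * cov j k)) =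
      - 2 * (1 / n * (1 - (real d + 1) * p i))" .
  show ?thesis
    unfolding skew_correction_def Let_def minv_H_V contraction using n_pos by (simp add: field_simps)
qed

section \<open>The weighted norm and the chi-squared divergence\<close>

text \<open>The first summand is the contribution of an implicit coordinate \<open>0\<close> with
  value \<open>- (\<Sum>i=1..d. x i)\<close>.\<close>

lemma wnorm_H_V:
  "wnorm d (H_V d N) x = sqrt (n * ((\<Sum>i=1..d. x i)\<^sup>2 / p 0 + (\<Sum>i=1..d. (x i)\<^sup>2 / p i)))"
proof -
  have "(\<Sum>i=1..d. \<Sum>j=1..d. x i * H_V d N i j * x j) =
     (\<Sum>i=1..d. \<Sum>j=1..d. n * (x i * x j / p 0 + (if i = j then (x i)\<^sup>2 / p i else 0)))"
    by (intro sum.cong) (auto simp: H_V_eq algebra_simps power2_eq_square)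
  also have "\<dots> = n * ((\<Sum>i=1..d. x i)\<^sup>2 / p 0 + (\<Sum>i=1..d. (x i)\<^sup>2 / p i))"
    by (simp add: sum.distrib power2_eq_square sum_product del: One_nat_def
        flip: sum_distrib_left sum_divide_distrib)
  finally show ?thesis
    by (simp add: wnorm_def)
qed

lemma chi2_Unif: "chi2 d (Unif d) p = (\<Sum>j=0..d. (1 / (real d + 1) - p j)\<^sup>2 / p j)"
  unfolding chi2_def Unif_def by (intro sum.cong) (auto simp: add_ac)

text \<open>Serves both estimates, since the skew correction and the remainder have this shape. As
  \<open>1 - (real d + 1) * p i\<close> sums to zero over \<open>0..d\<close>, the implicit
  coordinate \<open>0\<close> has the same shape, and factoring out \<open>real d + 1\<close> leaves
  the divergence.\<close>

lemma wnorm_affine: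
  assumes x: "\<And>i. i \<in> {1..d} \<Longrightarrow> x i = a * (1 - (real d + 1) * p i)"
  shows "wnorm d (H_V d N) x = \<bar>a\<bar> * (real d + 1) * sqrt n * sqrt (chi2 d (Unif d) p)"
proof -
  have "(\<Sum>i=1..d. x i) = a * (\<Sum>i=1..d. 1 - (real d + 1) * p i)"
    unfolding sum_distrib_left using x by (intro sum.cong) auto
  also have "(\<Sum>i=1..d. 1 - (real d + 1) * p i) = - (1 - (real d + 1) * p 0)"
    unfolding sum_subtractf sum_distrib_left[symmetric] sum_freq_tail by (simp add: algebra_simps)
  finally have sum_x: "(\<Sum>i=1..d. x i)\<^sup>2 = a\<^sup>2 * (1 - (real d + 1) * p 0)\<^sup>2"
    by (simp only: power_mult_distrib power2_minus)
  have "(\<Sum>i=1..d. x i)\<^sup>2 / p 0 + (\<Sum>i=1..d. (x i)\<^sup>2 / p i) =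
      (\<Sum>i=0..d. a\<^sup>2 * (1 - (real d + 1) * p i)\<^sup>2 / p i)"
    unfolding sum_split_0 sum_x using x by (simp add: power_mult_distrib)
  also have "\<dots> = (a * (real d + 1))\<^sup>2 * chi2 d (Unif d) p"
    unfolding chi2_Unif sum_distrib_left
  proof (intro sum.cong refl, goal_cases)
    case (1 i)
    have "1 - (real d + 1) * p i = (real d + 1) * (1 / (real d + 1) - p i)"
      by (simp add: right_diff_distrib)
    then show ?case
      by (simp add: power_mult_distrib)
  qed
  finally show ?thesis
    by (simp add: wnorm_H_V real_sqrt_mult abs_mult)
qed

lemma freq_min_props:
  "0 < freq_min d N" "freq_min d N \<le> 1" "j \<le> d \<Longrightarrow> freq_min d N \<le> p j"
proof -
  show le: "freq_min d N \<le> p j" if "j \<le> d" for j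
    using that unfolding freq_min_def by (intro Min_le) auto
  show "0 < freq_min d N"
    unfolding freq_min_def using freq_pos by (subst Min_gr_iff) auto
  have "p 0 \<le> 1"
    unfolding sum_freq[symmetric] using freq_pos by (intro member_le_sum) (auto simp: less_imp_le)
  with le[of 0] show "freq_min d N \<le> 1"
    by simp
qed

lemma chi2_nonneg: "chi2 d q p \<ge> 0"
  unfolding chi2_def using freq_pos by (auto intro!: sum_nonneg divide_nonneg_pos)

text \<open>Expanding the square, with \<open>u = 1 / (d + 1)\<close>, gives
  \<open>u\<^sup>2 * (\<Sum>j=0..d. 1 / p j) - 1\<close>. Bounding each \<open>1 / p j\<close> by
  \<open>1 / freq_min d N\<close> leaves at most \<open>u / freq_min d N - 1\<close>.\<close>

lemma chi2_Unif_le: "chi2 d (Unif d) p \<le> 1 / freq_min d N"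
proof -
  define u where "u = 1 / (real d + 1)"
  have u: "u > 0" "u \<le> 1" "(real d + 1) * u = 1"
    by (auto simp: u_def)
  have "chi2 d (Unif d) p = (\<Sum>j=0..d. u\<^sup>2 / p j - 2 * u + p j)"
    unfolding chi2_Unif u_def[symmetric]
  proof (intro sum.cong refl, goal_cases)
    case (1 j)
    then show ?case
      using freq_pos[of j] by (simp add: power2_eq_square field_simps)
  qed
  also have "\<dots> \<le> (\<Sum>j=0..d. u\<^sup>2 / freq_min d N - 2 * u + p j)"
    using freq_min_props by (intro sum_mono) (auto intro!: divide_left_mono mult_pos_pos freq_pos)
  also have "\<dots> = (real d + 1) * u * (u / freq_min d N - 2) + 1"
    by (simp add: sum.distrib sum_freq sum_subtractf power2_eq_square algebra_simps add_divide_distrib)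
  also have "\<dots> \<le> 1 / freq_min d N"
    using u(2) freq_min_props unfolding u(3) by (simp add: divide_right_mono add_increasing2 field_simps)
  finally show ?thesis .
qed

section \<open>The two norm bounds\<close>

text \<open>The norm equals \<open>(d + 1) * sqrt (chi2 d (Unif d) p) / sqrt n\<close>, and
  \<open>d + 1\<close> \<le> \<open>2 * d\<close> yields the constant \<open>2\<close>.\<close>

lemma wnorm_skew_correction_le:
  "wnorm d (H_V d N) (skew_correction d (V_pot d N) (p_pt d N))
    \<le> 2 * ((sqrt (chi2 d (Unif d) p) + 1) * (real d / sqrt n))"
proof -
  let ?s = "sqrt (chi2 d (Unif d) p)"
  have s: "?s \<ge> 0"
    using chi2_nonneg by simp
  have "wnorm d (H_V d N) (skew_correction d (V_pot d N) (p_pt d N)) = 1 / n * (real d + 1) * sqrt n * ?s"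
    using n_pos by (subst wnorm_affine[OF skew_correction_eq]) auto
  also have "\<dots> = ?s * ((real d + 1) / sqrt n)"
    using sqrt_divide_self_eq[of n] by (simp add: divide_inverse mult_ac)
  also have "\<dots> \<le> (?s + 1) * (2 * real d / sqrt n)"
    using s n_pos d_pos by (intro mult_mono divide_right_mono) auto
  finally show ?thesis
    by (simp add: mult_ac)
qed

text \<open>Mean minus mode is \<open>1 - (d + 1) * p i\<close> scaled by
  \<open>1 / (n + d + 1)\<close>, the skew correction is the same vector scaled by
  \<open>1 / n\<close>. Hence \<open>wnorm_affine\<close> applies with the difference
  \<open>a\<close>, which is of order \<open>d / n\<^sup>2\<close>.\<close>

lemma wnorm_mean_error_le:
  "wnorm d (H_V d N) (\<lambda>i. Dir_mean d (\<lambda>j. real (N j) + 1) i - Dir_mode d (\<lambda>j. real (N j) + 1) i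
      - skew_correction d (V_pot d N) (p_pt d N) i)
    \<le> 4 * (real d / sqrt (n * freq_min d N)) ^ 3"
proof -
  let ?D = "real d" and ?m = "freq_min d N"
  define a where "a = 1 / (n + ?D + 1) - 1 / n"
  have D: "?D \<ge> 1"
    using d_pos by simp
  have a: "\<bar>a\<bar> \<le> (?D + 1) / n\<^sup>2"
  proof -
    have "a = - (?D + 1) / (n * (n + ?D + 1))"
      using n_pos unfolding a_def by (simp add: field_simps)
    then have "\<bar>a\<bar> = (?D + 1) / (n * (n + ?D + 1))"
      using n_pos by (simp add: abs_mult)
    also have "\<dots> \<le> (?D + 1) / n\<^sup>2"
      using n_pos by (intro divide_left_mono) (auto simp: power2_eq_square)
    finally show ?thesis .
  qed
  have "wnorm d (H_V d N) (\<lambda>i. Dir_mean d (\<lambda>j. real (N j) + 1) i - Dir_mode d (\<lambda>j. real (N j) + 1) i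
      - skew_correction d (V_pot d N) (p_pt d N) i) = \<bar>a\<bar> * (?D + 1) * sqrt n * sqrt (chi2 d (Unif d) p)"
  proof (rule wnorm_affine)
    fix i assume i: "i \<in> {1..d}"
    have "(n * p i + 1) / (n + ?D + 1) - p i = 1 / (n + ?D + 1) * (1 - (?D + 1) * p i)"
      using n_pos by (simp add: field_simps)
    then show "Dir_mean d (\<lambda>j. real (N j) + 1) i - Dir_mode d (\<lambda>j. real (N j) + 1) i
        - skew_correction d (V_pot d N) (p_pt d N) i = a * (1 - (?D + 1) * p i)"
      unfolding Dir_mean_counts[OF i] skew_correction_eq[OF i] Dir_mode_eq a_def
      using i by (simp add: p_pt_def left_diff_distrib)
  qed
  also have "\<dots> \<le> (?D + 1) / n\<^sup>2 * (?D + 1) * sqrt n * (1 / sqrt ?m)"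
    using a n_pos real_sqrt_le_mono[OF chi2_Unif_le] chi2_nonneg
    by (intro mult_mono) (simp_all add: real_sqrt_divide)
  also have "\<dots> = (?D + 1)\<^sup>2 * (1 / (sqrt n ^ 3 * sqrt ?m))"
  proof -
    have "n\<^sup>2 = sqrt n ^ 3 * sqrt n"
      using n_pos by (simp add: power2_eq_square power3_eq_cube)
    then show ?thesis
      using n_pos by (simp add: power2_eq_square)
  qed
  \<comment> \<open>Raise both factors to cubes: \<open>(d + 1)\<^sup>2\<close> \<le>
    \<open>4 * d\<^sup>2\<close> \<le> \<open>4 * d ^ 3\<close> as \<open>d\<close> \<ge>
    \<open>1\<close>, and \<open>sqrt ?m ^ 3\<close> \<le> \<open>sqrt ?m\<close> as
    \<open>?m\<close> \<le> \<open>1\<close>.\<close>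
  also have "\<dots> \<le> 4 * ?D ^ 3 * (1 / (sqrt n ^ 3 * sqrt ?m ^ 3))"
  proof (intro mult_mono)
    have "(?D + 1)\<^sup>2 \<le> (2 * ?D)\<^sup>2"
      using D by (intro power_mono) auto
    also have "\<dots> \<le> 4 * ?D ^ 3"
      using D power_increasing[of 2 3 ?D] by (simp add: power_mult_distrib)
    finally show "(?D + 1)\<^sup>2 \<le> 4 * ?D ^ 3" .
    have "sqrt ?m ^ 3 \<le> sqrt ?m ^ 1"
      using freq_min_props(1,2) by (intro power_decreasing) auto
    then show "1 / (sqrt n ^ 3 * sqrt ?m) \<le> 1 / (sqrt n ^ 3 * sqrt ?m ^ 3)"
      using n_pos freq_min_props(1) by (intro divide_left_mono mult_left_mono) auto
  qed (use n_pos freq_min_props(1) in auto)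
  finally show ?thesis
    by (simp add: power_divide power_mult_distrib real_sqrt_mult)
qed

end

theorem proposition4p9:
  "\<exists>C>0. \<exists>C\<^sub>1>0. \<exists>C\<^sub>2>0. \<exists>c>0. \<forall>(d::nat) (N :: nat \<Rightarrow> nat).
     d \<ge> 1 \<longrightarrow> (\<forall>j\<in>{0..d}. freq d N j > 0) \<longrightarrow>
     (let n = real (total_count d N);
          p = freq d N;
          p_min = freq_min d N;
          \<alpha> = (\<lambda>j. real (N j) + 1);
          mean = Dir_mean d \<alpha>;
          mode = Dir_mode d \<alpha>;
          \<delta> = skew_correction d (V_pot d N) (p_pt d N);
          \<tau> = real d * exp (- C * sqrt (real d) * (n * p_min) powr (1/4))
      in
        wnorm d (H_V d N) \<delta> \<le> C\<^sub>1 * ((sqrt (chi2 d (Unif d) p) + 1) * (real d / sqrt n)) \<and>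
        ((real d)\<^sup>2 / (n * p_min) < c \<longrightarrow>
           wnorm d (H_V d N) (\<lambda>i. mean i - mode i - \<delta> i)
             \<le> C\<^sub>2 * ((real d / sqrt (n * p_min)) ^ 3 + \<tau>)))"
proof -
  \<comment> \<open>The constants are \<open>C = 1\<close> and \<open>c = 1\<close>, with
    \<open>C\<^sub>1 = 2\<close> and \<open>C\<^sub>2 = 4\<close> taken from the two norm
    bounds.\<close>
  have "let n = real (total_count d N);
          p = freq d N;
          p_min = freq_min d N;
          \<alpha> = (\<lambda>j. real (N j) + 1);
          mean = Dir_mean d \<alpha>;
          mode = Dir_mode d \<alpha>;
          \<delta> = skew_correction d (V_pot d N) (p_pt d N);
          \<tau> = real d * exp (- 1 * sqrt (real d) * (n * p_min) powr (1/4))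
      in
        wnorm d (H_V d N) \<delta> \<le> 2 * ((sqrt (chi2 d (Unif d) p) + 1) * (real d / sqrt n)) \<and>
        ((real d)\<^sup>2 / (n * p_min) < 1 \<longrightarrow>
           wnorm d (H_V d N) (\<lambda>i. mean i - mode i - \<delta> i)
             \<le> 4 * ((real d / sqrt (n * p_min)) ^ 3 + \<tau>))"
    if "d \<ge> 1" "\<forall>j\<in>{0..d}. freq d N j > 0" for d N
  proof -
    interpret positive_counts d N
      using that by unfold_locales auto
    \<comment> \<open>The exponential term is nonnegative, so it may be added to the cubic
      bound.\<close>
    have "4 * (real d / sqrt (n * freq_min d N)) ^ 3 \<le>
        4 * ((real d / sqrt (n * freq_min d N)) ^ 3 +
          real d * exp (- 1 * sqrt (real d) * (n * freq_min d N) powr (1/4)))"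
      by simp
    from order.trans[OF wnorm_mean_error_le this] wnorm_skew_correction_le show ?thesis
      unfolding Let_def by blast
  qed
  then show ?thesis
    by (intro exI[of _ "1::real"] exI[of _ "2::real"] exI[of _ "4::real"] conjI allI impI) simp_all
qed

end
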